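(* Let $N\ge 2$, let $\{x_i,\omega_i\}_{i=0}^{N}$ be the Legendre-Gauss-Lobatto nodes and weights, and let $\mathbf W=\operatorname{diag}(\omega_1,\ldots,\omega_{N-1})$. Let $\mathbf D^{(2)}$ be the interior second-order differentiation matrix and $\mathbf B$ the second-order Birkhoff integration matrix at these nodes. Then $$\mathbf W\mathbf D^{(2)}=(\mathbf D^{(2)})^{\intercal}\mathbf W,\qquad \mathbf W\mathbf B=\mathbf B^{\intercal}\mathbf W .$$
   Context: $\mathbb P_N$ is the space of real polynomials of degree at most $N$. The Legendre-Gauss-Lobatto (LGL) nodes $-1=x_0<x_1<\cdots<x_N=1$ are the zeros of $(1-x^2)L_N'(x)$ ($L_N$ the Legendre polynomial of degree $N$), with positive weights $\omega_j$ such that $\int_{-1}^1\phi(x)\,dx=\sum_{j=0}^N\phi(x_j)\omega_j$ for all $\phi\in\mathbb P_{2N-1}$. Let $\ell_j\in\mathbb P_N$, $0\le j\le N$, be the Lagrange basis polynomials, $\ell_j(x_i)=\delta_{ij}$. The interior second-order differentiation matrix is $\mathbf D^{(2)}=(\ell_j''(x_i))_{1\le i,j\le N-1}$. For $1\le j\le N-1$, $B_j\in\mathbb P_N$ is the unique polynomial with $B_j(\pm1)=0$ and $B_j''(x_i)=\delta_{ij}$ for $1\le i\le N-1$; the Birkhoff integration matrix is $\mathbf B=(B_j(x_i))_{1\le i,j\le N-1}$. It is known that $\mathbf D^{(2)}\mathbf B=\mathbf B\mathbf D^{(2)}=\mathbf I_{N-1}$. *)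

theory Defs
  imports "HOL-Analysis.Analysis" "HOL-Computational_Algebra.Polynomial"
    "Jordan_Normal_Form.Matrix"
begin

text \<open>Rodrigues' formula, normalised so that the value at \<open>1\<close> is \<open>1\<close>.\<close>

definition legendre :: "nat \<Rightarrow> real poly" where
  "legendre n = Polynomial.smult (1 / (2 ^ n * fact n)) ((pderiv ^^ n) ([:-1, 0, 1:] ^ n))"

text \<open>Only the values \<open>x 0, \<dots>, x N\<close> are constrained, and these are determined uniquely.\<close>

definition LGL_nodes :: "nat \<Rightarrow> (nat \<Rightarrow> real) \<Rightarrow> bool" where
  "LGL_nodes N x \<longleftrightarrow>
     x 0 = -1 \<and> x N = 1 \<and> strict_mono_on {..N} x \<and>
     x ` {..N} = {t. (1 - t\<^sup>2) * poly (pderiv (legendre N)) t = 0}"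

definition LGL_weights :: "nat \<Rightarrow> (nat \<Rightarrow> real) \<Rightarrow> (nat \<Rightarrow> real) \<Rightarrow> bool" where
  "LGL_weights N x w \<longleftrightarrow>
     (\<forall>j\<le>N. 0 < w j) \<and>
     (\<forall>p :: real poly. degree p \<le> 2 * N - 1 \<longrightarrow>
        integral {-1..1} (poly p) = (\<Sum>j\<le>N. poly p (x j) * w j))"

definition lagrange_basis :: "nat \<Rightarrow> (nat \<Rightarrow> real) \<Rightarrow> nat \<Rightarrow> real poly" where
  "lagrange_basis N x j =
     (THE p. degree p \<le> N \<and> (\<forall>i\<le>N. poly p (x i) = (if i = j then 1 else 0)))"

definition birkhoff_basis :: "nat \<Rightarrow> (nat \<Rightarrow> real) \<Rightarrow> nat \<Rightarrow> real poly" where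
  "birkhoff_basis N x j =
     (THE p. degree p \<le> N \<and> poly p (-1) = 0 \<and> poly p 1 = 0 \<and>
        (\<forall>i\<in>{1..N-1}. poly (pderiv (pderiv p)) (x i) = (if i = j then 1 else 0)))"

text \<open>Matrix entries are indexed from \<open>0\<close>, so entry \<open>(i, j)\<close> of the matrices below belongs
  to the interior nodes \<open>x (Suc i)\<close> and \<open>x (Suc j)\<close>.\<close>

definition diff_mat2 :: "nat \<Rightarrow> (nat \<Rightarrow> real) \<Rightarrow> real mat" where
  "diff_mat2 N x =
     Matrix.mat (N - 1) (N - 1)
       (\<lambda>(i, j). poly (pderiv (pderiv (lagrange_basis N x (Suc j)))) (x (Suc i)))"

definition birkhoff_mat :: "nat \<Rightarrow> (nat \<Rightarrow> real) \<Rightarrow> real mat" where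
  "birkhoff_mat N x =
     Matrix.mat (N - 1) (N - 1) (\<lambda>(i, j). poly (birkhoff_basis N x (Suc j)) (x (Suc i)))"

definition weight_mat :: "nat \<Rightarrow> (nat \<Rightarrow> real) \<Rightarrow> real mat" where
  "weight_mat N w = mat_diag (N - 1) (\<lambda>i. w (Suc i))"

text \<open>The two definite descriptions above are well defined.\<close>

lemma ex1_interpolation:
  fixes x :: "nat \<Rightarrow> real" and v :: "nat \<Rightarrow> real"
  assumes "finite I" "I \<noteq> {}" "inj_on x I"
  shows "\<exists>!p. degree p < card I \<and> (\<forall>i\<in>I. poly p (x i) = v i)"
proof (rule ex_ex1I)
  define l where "l = (\<lambda>j. Polynomial.smult (1 / (\<Prod>k\<in>I - {j}. x j - x k)) (\<Prod>k\<in>I - {j}. [:- x k, 1:]))"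
  define p where "p = (\<Sum>j\<in>I. Polynomial.smult (v j) (l j))"
  have dl: "degree (l j) < card I" if "j \<in> I" for j
  proof -
    have "degree (l j) \<le> degree (\<Prod>k\<in>I - {j}. [:- x k, 1:])"
      unfolding l_def by (rule degree_smult_le)
    also have "\<dots> \<le> (\<Sum>k\<in>I - {j}. degree [:- x k, 1:])"
      using degree_prod_sum_le[of "I - {j}" "\<lambda>k. [:- x k, 1:]"] assms(1) by (simp add: o_def)
    also have "\<dots> = card I - 1" using that assms(1) by simp
    finally show ?thesis using assms(1,2) card_gt_0_iff[of I] by linarith
  qed
  have vl: "poly (l j) (x i) = (if i = j then 1 else 0)" if "i \<in> I" "j \<in> I" for i j
  proof (cases "i = j")
    case True
    have "(\<Prod>k\<in>I - {j}. x j - x k) \<noteq> 0"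
      using assms(1,3) that by (auto simp: inj_on_def)
    then show ?thesis using True by (simp add: l_def poly_prod)
  next
    case False
    have "(\<Prod>k\<in>I - {j}. x i - x k) = 0"
      using assms(1) that False by auto
    then show ?thesis using False by (simp add: l_def poly_prod)
  qed
  have "degree p \<le> card I - 1"
    unfolding p_def using dl
    by (intro degree_sum_le assms(1) order_trans[OF degree_smult_le]) fastforce
  then have "degree p < card I" using assms(1,2) card_gt_0_iff[of I] by linarith
  moreover have "poly p (x i) = v i" if "i \<in> I" for i
  proof -
    have "poly p (x i) = (\<Sum>j\<in>I. if i = j then v j else 0)"
      unfolding p_def poly_sum by (rule sum.cong) (auto simp: vl that)
    then show ?thesis using that assms(1) by simp
  qed
  ultimately show "\<exists>p. degree p < card I \<and> (\<forall>i\<in>I. poly p (x i) = v i)" by blast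
next
  fix p q :: "real poly"
  assume p: "degree p < card I \<and> (\<forall>i\<in>I. poly p (x i) = v i)"
    and q: "degree q < card I \<and> (\<forall>i\<in>I. poly q (x i) = v i)"
  show "p = q"
    by (rule poly_eqI_degree[of "x ` I"]) (use p q assms(3) in \<open>auto simp: card_image\<close>)
qed

lemma lagrange_basis_ex1:
  fixes x :: "nat \<Rightarrow> real"
  assumes "inj_on x {..N}"
  shows "\<exists>!p. degree p \<le> N \<and> (\<forall>i\<le>N. poly p (x i) = (if i = j then 1 else 0))"
  using ex1_interpolation[of "{..N}" x "\<lambda>i. if i = j then 1 else 0"] assms
  by (simp add: less_Suc_eq_le Ball_def del: if_split)

lemma ex_antiderivative:
  fixes p :: "real poly"
  shows "\<exists>q. pderiv q = p \<and> degree q \<le> Suc (degree p)"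
proof -
  define q where "q = (\<Sum>i\<le>degree p. monom (coeff p i / real (Suc i)) (Suc i))"
  have "pderiv q = (\<Sum>i\<le>degree p. monom (coeff p i) i)"
    unfolding q_def higher_pderiv_sum[of 1, simplified] by (intro sum.cong) (auto simp: pderiv_monom simp del: of_nat_Suc)
  then have "pderiv q = p" by (simp add: poly_as_sum_of_monoms)
  moreover have "degree q \<le> Suc (degree p)"
    unfolding q_def by (intro degree_sum_le order_trans[OF degree_monom_le]) auto
  ultimately show ?thesis by blast
qed

lemma birkhoff_basis_ex1:
  fixes x :: "nat \<Rightarrow> real"
  assumes "2 \<le> N" "inj_on x {1..N-1}"
  shows "\<exists>!p. degree p \<le> N \<and> poly p (-1) = 0 \<and> poly p 1 = 0 \<and>
    (\<forall>i\<in>{1..N-1}. poly (pderiv (pderiv p)) (x i) = (if i = j then 1 else 0))"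
proof -
  have E: "\<exists>!p. degree p < N - 1 \<and> (\<forall>i\<in>{1..N-1}. poly p (x i) = (if i = j then 1 else 0))"
    using ex1_interpolation[of "{1..N-1}" x "\<lambda>i. if i = j then 1 else 0"] assms by simp
  show ?thesis
  proof (rule ex_ex1I)
    obtain r where r: "degree r < N - 1"
        "\<forall>i\<in>{1..N-1}. poly r (x i) = (if i = j then 1 else 0)"
      using E by blast
    obtain s where s: "pderiv s = r" "degree s \<le> Suc (degree r)"
      using ex_antiderivative by blast
    obtain t where t: "pderiv t = s" "degree t \<le> Suc (degree s)"
      using ex_antiderivative by blast
    define a where "a = (poly t 1 + poly t (-1)) / 2"
    define b where "b = (poly t 1 - poly t (-1)) / 2"
    define p where "p = t - [:a, b:]"
    have "degree p \<le> N"
      unfolding p_def using r s t assms by (intro degree_diff_le) auto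
    moreover have "poly p (-1) = 0" "poly p 1 = 0"
      by (auto simp: p_def a_def b_def field_simps)
    moreover have "pderiv (pderiv p) = r"
      by (simp add: p_def pderiv_diff s t pderiv_pCons)
    ultimately show "\<exists>p. degree p \<le> N \<and> poly p (-1) = 0 \<and> poly p 1 = 0 \<and>
        (\<forall>i\<in>{1..N-1}. poly (pderiv (pderiv p)) (x i) = (if i = j then 1 else 0))"
      using r(2) by metis
  next
    fix p q :: "real poly"
    assume p: "degree p \<le> N \<and> poly p (-1) = 0 \<and> poly p 1 = 0 \<and>
        (\<forall>i\<in>{1..N-1}. poly (pderiv (pderiv p)) (x i) = (if i = j then 1 else 0))"
      and q: "degree q \<le> N \<and> poly q (-1) = 0 \<and> poly q 1 = 0 \<and>
        (\<forall>i\<in>{1..N-1}. poly (pderiv (pderiv q)) (x i) = (if i = j then 1 else 0))"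
    have "pderiv (pderiv p) = pderiv (pderiv q)"
    proof (rule ex1E[OF E])
      fix r
      assume "\<forall>y. degree y < N - 1 \<and>
          (\<forall>i\<in>{1..N-1}. poly y (x i) = (if i = j then 1 else 0)) \<longrightarrow> y = r"
      moreover have "degree (pderiv (pderiv p)) < N - 1" "degree (pderiv (pderiv q)) < N - 1"
        using p q assms(1) by (auto simp: degree_pderiv)
      ultimately show ?thesis using p q by metis
    qed
    then have "pderiv (pderiv (p - q)) = 0" by (simp add: pderiv_diff)
    then have "degree (pderiv (p - q)) = 0" by (simp add: pderiv_eq_0_iff)
    then have "degree (p - q) \<le> 1" by (simp add: degree_pderiv)
    then show "p = q"
      using poly_eqI_degree[of "{-1, 1}" "p - q" 0] p q by (simp add: card_insert_if) metis
  qed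
qed

end

theory Submission
  imports Defs
begin

text \<open>For \<open>u, v\<close> of degree at most \<open>N\<close> that vanish at \<open>\<plusminus>1\<close>, the product \<open>u'' v\<close> has degree at most
  \<open>2N - 2\<close>, so its quadrature sum is exactly \<open>\<integral> u'' v = - \<integral> u' v'\<close>, which is symmetric in \<open>u\<close> and \<open>v\<close>.
  The endpoint terms of the sum vanish. Taking \<open>u, v\<close> among the interior Lagrange polynomials, for which
  \<open>v\<close> picks out one node, gives the symmetry of \<open>W D\<close>; taking them among the Birkhoff polynomials, for
  which \<open>u''\<close> picks out one node, gives that of \<open>W B\<close>.\<close>

lemma integral_poly_pderiv:
  fixes p :: "real poly"
  assumes "a \<le> b"
  shows "integral {a..b} (poly (pderiv p)) = poly p b - poly p a"
  using assms
  by (intro integral_unique fundamental_theorem_of_calculus)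
    (auto intro: poly_DERIV DERIV_subset
      simp flip: has_real_derivative_iff_has_vector_derivative)

text \<open>Lagrange's identity: \<open>u'' v - v'' u\<close> is the derivative of
  \<open>u' v - v' u\<close>, which vanishes at both endpoints because \<open>u\<close> and
  \<open>v\<close> do. This replaces two integrations by parts.\<close>

lemma integral_pderiv2_commute:
  fixes u v :: "real poly"
  assumes "a \<le> b" "poly u a = 0" "poly u b = 0" "poly v a = 0" "poly v b = 0"
  shows "integral {a..b} (poly (pderiv (pderiv u) * v)) = integral {a..b} (poly (pderiv (pderiv v) * u))"
proof -
  have int: "poly p integrable_on {a..b}" for p :: "real poly"
    by (intro integrable_continuous_real continuous_intros)
  have "pderiv (pderiv u * v - pderiv v * u) = pderiv (pderiv u) * v - pderiv (pderiv v) * u"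
    by (simp add: pderiv_diff pderiv_mult algebra_simps)
  then have "integral {a..b} (poly (pderiv (pderiv u) * v - pderiv (pderiv v) * u)) = 0"
    using integral_poly_pderiv[OF assms(1), of "pderiv u * v - pderiv v * u"] assms(2-) by simp
  moreover have "poly (pderiv (pderiv u) * v - pderiv (pderiv v) * u) =
      (\<lambda>t. poly (pderiv (pderiv u) * v) t - poly (pderiv (pderiv v) * u) t)"
    by auto
  ultimately show ?thesis
    by (simp only: integral_diff[OF int int])
qed

lemma LGL_pderiv2_commute:
  fixes u v :: "real poly"
  assumes "2 \<le> N" "LGL_nodes N x" "LGL_weights N x w"
    and u: "degree u \<le> N" "poly u (-1) = 0" "poly u 1 = 0"
    and v: "degree v \<le> N" "poly v (-1) = 0" "poly v 1 = 0"
  shows "(\<Sum>k\<in>{1..N-1}. poly (pderiv (pderiv u)) (x k) * poly v (x k) * w k) =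
         (\<Sum>k\<in>{1..N-1}. poly (pderiv (pderiv v)) (x k) * poly u (x k) * w k)"
proof -
  have x: "x 0 = -1" "x N = 1" using assms(2) by (auto simp: LGL_nodes_def)
  have quad: "integral {-1..1} (poly (pderiv (pderiv p) * q)) =
      (\<Sum>k\<in>{1..N-1}. poly (pderiv (pderiv p)) (x k) * poly q (x k) * w k)"
    if "degree p \<le> N" "degree q \<le> N" "poly q (-1) = 0" "poly q 1 = 0" for p q
  proof -
    have "degree (pderiv (pderiv p) * q) \<le> degree (pderiv (pderiv p)) + degree q"
      by (rule degree_mult_le)
    \<comment> \<open>Two derivatives leave degree at most \<open>N - 2\<close>, so the product
      stays within degree \<open>2 * N - 2\<close>, where the quadrature is exact.\<close>
    also have "\<dots> \<le> 2 * N - 1"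
      using that assms(1) by (auto simp: degree_pderiv)
    finally have "integral {-1..1} (poly (pderiv (pderiv p) * q)) =
        (\<Sum>k\<le>N. poly (pderiv (pderiv p) * q) (x k) * w k)"
      using assms(3) by (simp add: LGL_weights_def)
    also have "\<dots> = (\<Sum>k\<in>{1..N-1}. poly (pderiv (pderiv p) * q) (x k) * w k)"
    proof (rule sum.mono_neutral_right)
      show "\<forall>k\<in>{..N} - {1..N-1}. poly (pderiv (pderiv p) * q) (x k) * w k = 0"
      proof
        fix k assume "k \<in> {..N} - {1..N-1}"
        then have "k = 0 \<or> k = N" by auto
        then show "poly (pderiv (pderiv p) * q) (x k) * w k = 0" using that x by auto
      qed
    qed auto
    finally show ?thesis by simp
  qed
  show ?thesis
    using integral_pderiv2_commute[of "-1" 1 u v] u v quad[of u v] quad[of v u] by simp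
qed

lemma LGL_nodes_inj_on: "LGL_nodes N x \<Longrightarrow> inj_on x {..N}"
  by (auto simp: LGL_nodes_def intro: strict_mono_on_imp_inj_on)

lemma lagrange_basis:
  fixes x :: "nat \<Rightarrow> real"
  assumes "inj_on x {..N}"
  shows "degree (lagrange_basis N x j) \<le> N"
    and "i \<le> N \<Longrightarrow> poly (lagrange_basis N x j) (x i) = (if i = j then 1 else 0)"
  using theI'[OF lagrange_basis_ex1[OF assms, of j]]
  unfolding lagrange_basis_def by blast+

lemma birkhoff_basis:
  fixes x :: "nat \<Rightarrow> real"
  assumes "2 \<le> N" "inj_on x {1..N-1}"
  shows "degree (birkhoff_basis N x j) \<le> N"
    and "poly (birkhoff_basis N x j) (-1) = 0" and "poly (birkhoff_basis N x j) 1 = 0"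
    and "i \<in> {1..N-1} \<Longrightarrow>
      poly (pderiv (pderiv (birkhoff_basis N x j))) (x i) = (if i = j then 1 else 0)"
  using theI'[OF birkhoff_basis_ex1[OF assms, of j]]
  unfolding birkhoff_basis_def by blast+

lemma LGL_lagrange_symmetric:
  assumes "2 \<le> N" "LGL_nodes N x" "LGL_weights N x w" and ij: "i \<in> {1..N-1}" "j \<in> {1..N-1}"
  shows "w i * poly (pderiv (pderiv (lagrange_basis N x j))) (x i) =
         w j * poly (pderiv (pderiv (lagrange_basis N x i))) (x j)"
proof -
  let ?l = "lagrange_basis N x"
  note l = lagrange_basis[OF LGL_nodes_inj_on[OF assms(2)]]
  have x: "x 0 = -1" "x N = 1" using assms(2) by (auto simp: LGL_nodes_def)
  \<comment> \<open>The endpoints are the nodes of index \<open>0\<close> and \<open>N\<close>, both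
    different from an interior \<open>m\<close>.\<close>
  have bdry: "poly (?l m) (-1) = 0" "poly (?l m) 1 = 0" if "m \<in> {1..N-1}" for m
    using l(2)[of 0 m] l(2)[of N m] x that by auto
  have pick: "(\<Sum>k\<in>{1..N-1}. poly q (x k) * poly (?l m) (x k) * w k) = w m * poly q (x m)"
    if "m \<in> {1..N-1}" for m q
  proof -
    have "(\<Sum>k\<in>{1..N-1}. poly q (x k) * poly (?l m) (x k) * w k) =
        (\<Sum>k\<in>{1..N-1}. if k = m then w k * poly q (x k) else 0)"
      using l(2) by (intro sum.cong) auto
    then show ?thesis using that by simp
  qed
  show ?thesis
    \<comment> \<open>Here \<open>u\<close> is \<open>?l j\<close> and \<open>v\<close> is
      \<open>?l i\<close>, so the undifferentiated factor samples the left sum at \<open>x i\<close>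
      and the right sum at \<open>x j\<close>.\<close>
    using LGL_pderiv2_commute[OF assms(1-3) l(1) bdry[OF ij(2)] l(1) bdry[OF ij(1)]]
      pick[OF ij(1)] pick[OF ij(2)] by simp
qed

lemma LGL_birkhoff_symmetric:
  assumes "2 \<le> N" "LGL_nodes N x" "LGL_weights N x w" and ij: "i \<in> {1..N-1}" "j \<in> {1..N-1}"
  shows "w i * poly (birkhoff_basis N x j) (x i) = w j * poly (birkhoff_basis N x i) (x j)"
proof -
  let ?B = "birkhoff_basis N x"
  have "inj_on x {1..N-1}"
    using LGL_nodes_inj_on[OF assms(2)] by (rule inj_on_subset) auto
  note B = birkhoff_basis[OF assms(1) this]
  \<comment> \<open>The roles are exchanged compared with the Lagrange case: now the differentiated
    factor does the sampling, and \<open>q\<close> will be the other Birkhoff polynomial.\<close>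
  have pick: "(\<Sum>k\<in>{1..N-1}. poly (pderiv (pderiv (?B m))) (x k) * poly q (x k) * w k) =
      w m * poly q (x m)" if "m \<in> {1..N-1}" for m q
  proof -
    have "(\<Sum>k\<in>{1..N-1}. poly (pderiv (pderiv (?B m))) (x k) * poly q (x k) * w k) =
        (\<Sum>k\<in>{1..N-1}. if k = m then w k * poly q (x k) else 0)"
      using B(4) by (intro sum.cong) auto
    then show ?thesis using that by simp
  qed
  show ?thesis
    using LGL_pderiv2_commute[OF assms(1-3) B(1-3) B(1-3), of i j]
      pick[OF ij(1)] pick[OF ij(2)] by simp
qed

text \<open>A diagonal factor scales rows from the left and columns from the right, so the matrix
  identity reduces to one scalar symmetry per entry.\<close>

lemma mat_diag_mult_eq_transpose_mult:
  fixes A :: "'a :: comm_semiring_1 mat"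
  assumes "A \<in> carrier_mat n n"
    and "\<And>i j. i < n \<Longrightarrow> j < n \<Longrightarrow> d i * A $$ (i, j) = d j * A $$ (j, i)"
  shows "mat_diag n d * A = transpose_mat A * mat_diag n d"
  using assms
  by (intro eq_matI) (auto simp: mat_diag_mult_left[of A n n] mat_diag_mult_right[of "transpose_mat A" n n] mult.commute)

theorem lemma2p1:
  fixes N :: nat and x w :: "nat \<Rightarrow> real"
  assumes "2 \<le> N" and "LGL_nodes N x" and "LGL_weights N x w"
  shows "weight_mat N w * diff_mat2 N x = transpose_mat (diff_mat2 N x) * weight_mat N w \<and>
         weight_mat N w * birkhoff_mat N x = transpose_mat (birkhoff_mat N x) * weight_mat N w"
  unfolding weight_mat_def
proof (intro conjI mat_diag_mult_eq_transpose_mult)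
  show "diff_mat2 N x \<in> carrier_mat (N - 1) (N - 1)"
    and "birkhoff_mat N x \<in> carrier_mat (N - 1) (N - 1)"
    by (auto simp: diff_mat2_def birkhoff_mat_def)
next
  \<comment> \<open>The shift by \<open>Suc\<close> turns the matrix indices into interior node
    indices in \<open>{1..N-1}\<close>.\<close>
  fix i j assume "i < N - 1" "j < N - 1"
  then show "w (Suc i) * diff_mat2 N x $$ (i, j) = w (Suc j) * diff_mat2 N x $$ (j, i)"
    and "w (Suc i) * birkhoff_mat N x $$ (i, j) = w (Suc j) * birkhoff_mat N x $$ (j, i)"
    using LGL_lagrange_symmetric[OF assms, of "Suc i" "Suc j"]
      LGL_birkhoff_symmetric[OF assms, of "Suc i" "Suc j"]
    by (auto simp: diff_mat2_def birkhoff_mat_def)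
qed

end
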